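(* (a) Let $G=(V,E)$ be a finite simple connected graph with $|V|\ge 2$, and let $p_G$ be its blowup-polynomial. The symmetries of $p_G$ coincide with the auto-isometries of $G$: a bijection $\sigma:V\to V$ satisfies $p_G(\{n_{\sigma(v)}\}_{v\in V})=p_G(\{n_v\}_{v\in V})$ (i.e. $p_G$ is invariant under the substitution $n_v\mapsto n_{\sigma(v)}$ for all $v$) if and only if $\sigma$ is a graph automorphism of $G$. (b) More strongly, $p_G$ recovers $G$: if $G$ and $H$ are finite simple connected graphs on the same vertex set $V$, with $|V|\ge 2$, and $p_G=p_H$ as polynomials in $\{n_v: v\in V\}$, then $G=H$. (c) The univariate blowup-polynomial does not recover the graph: there exist non-isomorphic finite simple connected graphs $G,H$, each with at least two vertices, such that $u_G=u_H$.
   Context: For a finite simple connected graph $H$, its distance matrix $D_H$ is the matrix indexed by $V(H)\times V(H)$ whose $(v,w)$ entry is the length of a shortest path from $v$ to $w$ if $v\ne w$, and $0$ if $v=w$. Given a finite simple connected graph $G=(V,E)$ with $|V|\ge 2$ and positive integers $\mathbf n=\{n_v: v\in V\}$, the blowup graph $G[\mathbf n]$ is the finite simple connected graph having $n_v$ copies of each vertex $v\in V$, in which a copy of $v$ is adjacent to a copy of $w$ if and only if $v\neq w$ and $(v,w)\in E$. The blowup-polynomial of $G$ is the unique polynomial $p_G(\mathbf n)\in\mathbb{Z}[\{n_v: v\in V\}]$ (it is known to exist) such that $\det D_{G[\mathbf n]}=(-2)^{\sum_{v}(n_v-1)}p_G(\mathbf n)$ for all $\mathbf n\in\mathbb{Z}_{>0}^V$;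 here the $n_v$ are regarded as indeterminates. The univariate blowup-polynomial of $G$ is $u_G(n):=p_G(n,n,\dots,n)$. An auto-isometry of $G$ is an adjacency-preserving bijection of $V$ (graph automorphism). *)

theory Defs
  imports
    "Graph_Theory.Graph_Theory"
    "Jordan_Normal_Form.Determinant"
    "HOL-Library.Poly_Mapping"
    "HOL-Computational_Algebra.Polynomial"
    "HOL-Combinatorics.Permutations"
begin

text \<open>
  A finite simple graph is a \<open>pair_graph\<close>: its set of arcs is a symmetric, irreflexive
  relation on a finite vertex set, an edge being represented by its two orientations.
\<close>

definition simple_connected_graph :: "'a pair_pre_digraph \<Rightarrow> bool" where
  "simple_connected_graph G \<longleftrightarrow> pair_graph G \<and> Digraph_Component.connected (with_proj G)"

definition distance_matrix :: "'a pair_pre_digraph \<Rightarrow> 'a \<Rightarrow> 'a \<Rightarrow> int" where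
  "distance_matrix G v w =
     (if v = w then 0
      else int (LEAST k. \<exists>p. pre_digraph.apath (with_proj G) v p w \<and> length p = k))"

text \<open>
  The determinant of a matrix indexed by \<open>I \<times> I\<close> for a finite set \<open>I\<close>, which is not assumed
  to be ordered. The lemma below shows that it is the value of
  \<open>Determinant.det\<close> for every enumeration of \<open>I\<close>.
\<close>

definition set_det :: "'i set \<Rightarrow> ('i \<Rightarrow> 'i \<Rightarrow> int) \<Rightarrow> int" where
  "set_det I M = (\<Sum>p | p permutes I. sign p * (\<Prod>i\<in>I. M i (p i)))"

lemma set_det_eq_det:
  assumes f: "bij_betw f {0..<m} I"
  shows "set_det I M = det (mat m m (\<lambda>(i, j). M (f i) (f j)))"
proof -
  let ?A = "{0..<m}" and ?h = "map_permutation {0..<m} f"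
  have inj: "inj_on f ?A" and img: "f ` ?A = I"
    using f by (auto simp: bij_betw_def)
  have "bij_betw (\<lambda>p x. if x \<in> I then f (p (inv_into ?A f x)) else x)
          {p. p permutes ?A} {p. p permutes I}"
    by (rule bij_betw_permutations[OF f])
  also have "(\<lambda>p x. if x \<in> I then f (p (inv_into ?A f x)) else x) = ?h"
    by (auto simp: fun_eq_iff map_permutation_def restrict_id_def img)
  finally have bij: "bij_betw ?h {p. p permutes ?A} {p. p permutes I}" .
  have term_eq: "sign (?h p) * (\<Prod>i\<in>I. M i (?h p i)) = sign p * (\<Prod>i = 0..<m. M (f i) (f (p i)))"
    if p: "p permutes ?A" for p
  proof -
    have "(\<Prod>i\<in>I. M i (?h p i)) = (\<Prod>i\<in>?A. M (f i) (?h p (f i)))"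
      by (rule prod.reindex_bij_betw[OF f, symmetric])
    also have "\<dots> = (\<Prod>i\<in>?A. M (f i) (f (p i)))"
      by (intro prod.cong refl) (simp add: map_permutation_apply[OF inj])
    finally show ?thesis
      by (simp add: sign_map_permutation[OF inj p])
  qed
  have "set_det I M = (\<Sum>p | p permutes ?A. sign (?h p) * (\<Prod>i\<in>I. M i (?h p i)))"
    unfolding set_det_def by (rule sum.reindex_bij_betw[OF bij, symmetric])
  also have "\<dots> = (\<Sum>p | p permutes ?A. sign p * (\<Prod>i = 0..<m. M (f i) (f (p i))))"
    by (intro sum.cong refl term_eq) simp
  also have "\<dots> = det (mat m m (\<lambda>(i, j). M (f i) (f j)))"
    by (simp add: det_def)
  finally show ?thesis .
qed

definition blowup :: "'a pair_pre_digraph \<Rightarrow> ('a \<Rightarrow> nat) \<Rightarrow> ('a \<times> nat) pair_pre_digraph" where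
  "blowup G n =
     \<lparr>pverts = (SIGMA v : pverts G. {..<n v}),
      parcs = {((v, i), (w, j)) | v i w j.
                 v \<noteq> w \<and> (v, w) \<in> parcs G \<and> i < n v \<and> j < n w}\<rparr>"

text \<open>
  Integer polynomials in indeterminates of type \<open>'v\<close>: finitely supported coefficient functions
  on monomials, a monomial being a finitely supported function \<open>'v \<Rightarrow> nat\<close> of exponents.
\<close>

type_synonym 'v int_mpoly = "('v \<Rightarrow>\<^sub>0 nat) \<Rightarrow>\<^sub>0 int"

definition indeterminate :: "'v \<Rightarrow> 'v int_mpoly" where
  "indeterminate v = Poly_Mapping.single (Poly_Mapping.single v 1) 1"

definition mpoly_vars :: "'v int_mpoly \<Rightarrow> 'v set" where
  "mpoly_vars p = (\<Union>m \<in> Poly_Mapping.keys p. Poly_Mapping.keys m)"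

text \<open>
  Substitution of elements of an arbitrary commutative ring for the indeterminates; this covers
  numerical evaluation as well as substitution of polynomials.
\<close>

definition mpoly_subst :: "('v \<Rightarrow> 'r::comm_ring_1) \<Rightarrow> 'v int_mpoly \<Rightarrow> 'r" where
  "mpoly_subst x p =
     (\<Sum>m \<in> Poly_Mapping.keys p.
        of_int (Poly_Mapping.lookup p m) *
        (\<Prod>v \<in> Poly_Mapping.keys m. x v ^ Poly_Mapping.lookup m v))"

definition is_blowup_polynomial :: "'a pair_pre_digraph \<Rightarrow> 'a int_mpoly \<Rightarrow> bool" where
  "is_blowup_polynomial G p \<longleftrightarrow>
     mpoly_vars p \<subseteq> pverts G \<and>
     (\<forall>n. (\<forall>v \<in> pverts G. n v > 0) \<longrightarrow>
        set_det (pverts (blowup G n)) (distance_matrix (blowup G n)) =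
          (- 2) ^ (\<Sum>v \<in> pverts G. n v - 1) * mpoly_subst (\<lambda>v. int (n v)) p)"

definition blowup_polynomial :: "'a pair_pre_digraph \<Rightarrow> 'a int_mpoly" where
  "blowup_polynomial G = (THE p. is_blowup_polynomial G p)"

definition univariate_blowup_polynomial :: "'a pair_pre_digraph \<Rightarrow> int poly" where
  "univariate_blowup_polynomial G = mpoly_subst (\<lambda>_. [:0, 1:]) (blowup_polynomial G)"

definition auto_isometry :: "'a pair_pre_digraph \<Rightarrow> ('a \<Rightarrow> 'a) \<Rightarrow> bool" where
  "auto_isometry G \<sigma> \<longleftrightarrow>
     bij_betw \<sigma> (pverts G) (pverts G) \<and>
     (\<forall>v \<in> pverts G. \<forall>w \<in> pverts G. (\<sigma> v, \<sigma> w) \<in> parcs G \<longleftrightarrow> (v, w) \<in> parcs G)"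

end

theory Submission
  imports Defs
begin

text \<open>
  Write \<open>d\<close> for the distance of \<open>G\<close>, \<open>k\<close> for its number of vertices, and let
  \<open>M v w = d v w\<close> for \<open>v \<noteq> w\<close> and \<open>M v v = 2\<close>. Two copies of one vertex are at distance 2 in a
  blowup (through a neighbour), copies of different vertices keep their distance. Hence the
  distance matrix of the blowup is \<open>M\<close> with its index \<open>v\<close> repeated \<open>n v\<close> times, minus 2 times the
  identity. Expanding the determinant along the subtracted scalar matrix gives a sum of principal
  minors of the repeated matrix. A minor that uses two copies of one vertex vanishes, and the
  minors with one copy of each vertex in \<open>T\<close> are all \<open>det M\<close> restricted to \<open>T\<close>; there are as many
  as the product of the \<open>n v\<close> over \<open>T\<close>. So the blowup-polynomial is explicitly
  \[ p_G = \sum_{T \subseteq V} (-2)^{k - |T|} \det(M_T) \prod_{v \in T} n_v \]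
  (\<open>blowup_polynomial_eq\<close>), where uniqueness holds because an integer polynomial is determined by
  its values at positive integers.

  The coefficient of \<open>n v * n w\<close> is a fixed power of -2 times \<open>4 - (d v w)^2\<close>. It therefore reveals
  whether \<open>d v w = 1\<close>, i.e. whether \<open>v\<close> and \<open>w\<close> are adjacent: \<open>p_G\<close> recovers \<open>G\<close>
  (\<open>blowup_polynomial_inj\<close>), and a permutation of the variables that fixes \<open>p_G\<close> preserves
  adjacency. Conversely an auto-isometry preserves distances, hence all the minors
  (\<open>blowup_polynomial_symmetry_iff\<close>).

  Setting all variables to \<open>t\<close> gives \<open>u_G(t) = det (t M - 2 I)\<close>, which depends only on the spectrum
  of \<open>M\<close>. Two graphs on seven vertices whose matrices \<open>M\<close> are conjugate, by a switching in the
  manner of Godsil and McKay, but whose degrees differ, have the same univariate polynomial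
  (\<open>mates_univariate_eq\<close>, \<open>mates_not_iso\<close>).
\<close>

section \<open>Determinants indexed by finite sets\<close>

lemma set_det_cong:
  assumes "\<And>i j. i \<in> I \<Longrightarrow> j \<in> I \<Longrightarrow> A i j = B i j"
  shows "set_det I A = set_det I B"
  unfolding set_det_def
proof (intro sum.cong refl)
  fix p assume "p \<in> {p. p permutes I}"
  then have "(\<Prod>i\<in>I. A i (p i)) = (\<Prod>i\<in>I. B i (p i))"
    by (intro prod.cong refl assms) (auto simp: permutes_in_image)
  then show "sign p * (\<Prod>i\<in>I. A i (p i)) = sign p * (\<Prod>i\<in>I. B i (p i))" by simp
qed

lemma set_det_empty [simp]: "set_det {} A = 1"
  by (simp add: set_det_def)

lemma set_det_scale:
  "set_det I (\<lambda>i j. t * A i j) = t ^ card I * set_det I A"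
  by (simp add: set_det_def prod.distrib sum_distrib_left algebra_simps)

lemma set_det_reindex:
  assumes "finite I" "inj_on f I"
  shows "set_det I (\<lambda>i j. A (f i) (f j)) = set_det (f ` I) A"
proof -
  obtain g where g: "bij_betw g {0..<card I} I"
    using ex_bij_betw_nat_finite[OF assms(1)] by blast
  have fg: "bij_betw (f \<circ> g) {0..<card I} (f ` I)"
    using g assms(2) by (intro bij_betw_trans[OF g]) (simp add: bij_betw_def)
  show ?thesis
    by (simp add: set_det_eq_det[OF g] set_det_eq_det[OF fg])
qed

text \<open>
  Two distinct indices with the same image under \<open>f\<close> give two equal rows.
\<close>

lemma set_det_eq_0_if_not_inj:
  assumes "finite I" "\<not> inj_on f I"
  shows "set_det I (\<lambda>i j. A (f i) (f j)) = 0"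
proof -
  obtain g where g: "bij_betw g {0..<card I} I"
    using ex_bij_betw_nat_finite[OF assms(1)] by blast
  from assms(2) obtain x y where xy: "x \<in> I" "y \<in> I" "x \<noteq> y" "f x = f y"
    by (auto simp: inj_on_def)
  have "x \<in> g ` {0..<card I}" "y \<in> g ` {0..<card I}"
    using xy(1,2) g by (simp_all add: bij_betw_def)
  then obtain i j where ij: "i < card I" "j < card I" "g i = x" "g j = y"
    by fastforce
  have "det (mat (card I) (card I) (\<lambda>(i, j). A (f (g i)) (f (g j)))) = 0"
    by (rule det_identical_rows[where n = "card I" and i = i and j = j])
      (use ij xy in \<open>auto intro!: eq_vecI\<close>)
  then show ?thesis by (simp add: set_det_eq_det[OF g])
qed

lemma set_det_mult:
  assumes "finite I"
  shows "set_det I (\<lambda>i j. \<Sum>k\<in>I. A i k * B k j) = set_det I A * set_det I B"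
proof -
  let ?m = "card I"
  obtain g where g: "bij_betw g {0..<?m} I"
    using ex_bij_betw_nat_finite[OF assms(1)] by blast
  let ?M = "\<lambda>A. mat ?m ?m (\<lambda>(i, j). A (g i) (g j))"
  have "?M (\<lambda>i j. \<Sum>k\<in>I. A i k * B k j) = ?M A * ?M B"
    by (rule eq_matI)
      (simp_all add: scalar_prod_def sum.reindex_bij_betw[OF g, symmetric])
  then show ?thesis
    by (simp add: set_det_eq_det[OF g] det_mult[of _ ?m])
qed

text \<open>
  The expansion of the characteristic polynomial into principal minors. In the product over the
  rows, choose the set \<open>S\<close> of rows that contribute an entry of \<open>A\<close>. The other rows contribute a
  diagonal entry \<open>c\<close>, so only the permutations that fix every index outside \<open>S\<close> survive, and
  these are the permutations of \<open>S\<close>.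
\<close>

lemma set_det_add_scalar:
  assumes "finite I"
  shows "set_det I (\<lambda>i j. A i j + (if i = j then c else 0)) =
    (\<Sum>S\<in>Pow I. c ^ (card I - card S) * set_det S A)"
proof -
  let ?P = "\<lambda>S. {p. p permutes S}"
  let ?\<delta> = "\<lambda>i j. if i = j then c else 0"
  have expand: "(\<Prod>i\<in>I. A i (p i) + ?\<delta> i (p i)) =
      (\<Sum>S\<in>Pow I. (\<Prod>i\<in>S. A i (p i)) * (\<Prod>i\<in>I - S. ?\<delta> i (p i)))" for p
    by (rule prod_add[OF assms])
  have minor: "(\<Sum>p\<in>?P I. sign p * ((\<Prod>i\<in>S. A i (p i)) * (\<Prod>i\<in>I - S. ?\<delta> i (p i)))) =
      c ^ (card I - card S) * set_det S A" if S: "S \<subseteq> I" for S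
  proof -
    have fin: "finite S" "finite (I - S)"
      using assms S finite_subset by auto
    have sub: "?P S \<subseteq> ?P I"
      using S by (auto intro: permutes_subset)
    have zero: "(\<Prod>i\<in>I - S. ?\<delta> i (p i)) = 0" if p: "p \<in> ?P I - ?P S" for p
    proof -
      have "\<exists>i\<in>I - S. i \<noteq> p i"
      proof (rule ccontr)
        assume "\<not> ?thesis"
        then have "p permutes S"
          using p by (intro permutes_superset[of p I S]) auto
        with p show False by simp
      qed
      then obtain i where "i \<in> I - S" "?\<delta> i (p i) = 0" by auto
      then show ?thesis by (intro prod_zero[OF fin(2)] bexI[of _ i])
    qed
    have fixed: "(\<Prod>i\<in>I - S. ?\<delta> i (p i)) = c ^ (card I - card S)" if p: "p permutes S" for p
    proof -
      have "(\<Prod>i\<in>I - S. ?\<delta> i (p i)) = (\<Prod>i\<in>I - S. c)"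
        by (intro prod.cong) (use p in \<open>auto simp: permutes_not_in\<close>)
      also have "\<dots> = c ^ (card I - card S)"
        using S fin by (simp add: card_Diff_subset)
      finally show ?thesis .
    qed
    have "(\<Sum>p\<in>?P I. sign p * ((\<Prod>i\<in>S. A i (p i)) * (\<Prod>i\<in>I - S. ?\<delta> i (p i)))) =
        (\<Sum>p\<in>?P S. sign p * ((\<Prod>i\<in>S. A i (p i)) * (\<Prod>i\<in>I - S. ?\<delta> i (p i))))"
      by (rule sum.mono_neutral_right[OF finite_permutations[OF assms] sub])
        (simp add: zero del: prod_zero_iff)
    also have "\<dots> = (\<Sum>p\<in>?P S. c ^ (card I - card S) * (sign p * (\<Prod>i\<in>S. A i (p i))))"
      by (intro sum.cong refl) (simp add: fixed)
    also have "\<dots> = c ^ (card I - card S) * set_det S A"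
      by (simp add: set_det_def sum_distrib_left)
    finally show ?thesis .
  qed
  have "set_det I (\<lambda>i j. A i j + ?\<delta> i j) =
      (\<Sum>p\<in>?P I. \<Sum>S\<in>Pow I. sign p * ((\<Prod>i\<in>S. A i (p i)) * (\<Prod>i\<in>I - S. ?\<delta> i (p i))))"
    by (simp only: set_det_def expand sum_distrib_left)
  also have "\<dots> = (\<Sum>S\<in>Pow I. c ^ (card I - card S) * set_det S A)"
    by (subst sum.swap) (intro sum.cong refl minor, simp)
  finally show ?thesis .
qed

lemma set_det_scalar:
  fixes I :: "'i set"
  assumes "finite I"
  shows "set_det I (\<lambda>i j. if i = j then c else 0) = c ^ card I"
proof -
  have zero: "set_det S (\<lambda>i j. 0) = 0" if "S \<in> Pow I - {{}}" for S :: "'i set"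
  proof -
    from that assms have "finite S" "S \<noteq> {}" by (auto dest: finite_subset)
    then have power: "(0::int) ^ card S = 0" by (simp add: card_gt_0_iff)
    show ?thesis
      by (rule set_det_scale[of S 0 "\<lambda>i j. 0", unfolded power mult_zero_left])
  qed
  have "(\<Sum>S\<in>Pow I. c ^ (card I - card S) * set_det S (\<lambda>i j. 0)) =
      (\<Sum>S\<in>{{} :: 'i set}. c ^ (card I - card S) * set_det S (\<lambda>i j. 0))"
    by (rule sum.mono_neutral_right) (use assms in \<open>auto simp: zero\<close>)
  with set_det_add_scalar[OF assms, of "\<lambda>i j. 0" c] show ?thesis by simp
qed

lemma set_det_doubleton:
  assumes "v \<noteq> w"
  shows "set_det {v, w} A = A v v * A w w - A v w * A w v"
proof -
  have perms: "{p. p permutes {v, w}} = {id, transpose v w}"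
    by (auto simp: permutes_doubleton_iff)
  have "id \<noteq> transpose v w"
    using assms by (metis id_apply transpose_apply_first)
  then show ?thesis
    using assms by (simp add: set_det_def perms sign_swap_id)
qed

section \<open>Integer polynomials in several indeterminates\<close>

text \<open>
  The exponent vectors are given as a family \<open>e\<close> whose members are distinct on \<open>V\<close>, so that the
  induction on \<open>V\<close> can restrict them. Fix positive values of the other variables: the sum is then a
  polynomial in the variable \<open>u\<close> with infinitely many zeros, so each of its coefficients vanishes.
  The coefficient of the power \<open>k\<close> is a sum over the exponent vectors with value \<open>k\<close> at \<open>u\<close>; they
  are still distinct after \<open>u\<close> is dropped, and the induction hypothesis applies to them.
\<close>

lemma coefficients_eq_0_if_vanishing_on_positives:
  fixes c :: "'m \<Rightarrow> int" and e :: "'m \<Rightarrow> 'v \<Rightarrow> nat"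
  assumes "finite V" "finite M"
    and "\<And>m m'. m \<in> M \<Longrightarrow> m' \<in> M \<Longrightarrow> (\<forall>v\<in>V. e m v = e m' v) \<Longrightarrow> m = m'"
    and "\<And>x :: 'v \<Rightarrow> nat. (\<forall>v\<in>V. x v > 0) \<Longrightarrow> (\<Sum>m\<in>M. c m * (\<Prod>v\<in>V. int (x v) ^ e m v)) = 0"
    and "m \<in> M"
  shows "c m = 0"
  using assms
proof (induction V arbitrary: M m rule: finite_induct)
  case empty
  then have "M = {m}" by auto
  with empty.prems(3)[of "\<lambda>_. 1"] show ?case by simp
next
  case (insert u V)
  let ?k = "e m u"
  define a where "a x m' = c m' * (\<Prod>v\<in>V. int (x v) ^ e m' v)" for x :: "'v \<Rightarrow> nat" and m'
  have slice: "(\<Sum>m'\<in>{m' \<in> M. e m' u = ?k}. a x m') = 0" if pos: "\<forall>v\<in>V. x v > 0" for x :: "'v \<Rightarrow> nat"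
  proof -
    define q where "q = (\<Sum>m'\<in>M. monom (a x m') (e m' u))"
    have "poly q (int t) = 0" if t: "t > 0" for t
    proof -
      let ?y = "x(u := t)"
      have y: "(\<Prod>v\<in>V. int (?y v) ^ e m' v) = (\<Prod>v\<in>V. int (x v) ^ e m' v)" for m'
        by (intro prod.cong) (use insert.hyps in auto)
      have "0 = (\<Sum>m'\<in>M. c m' * (\<Prod>v\<in>insert u V. int (?y v) ^ e m' v))"
        by (rule insert.prems(3)[symmetric]) (use pos t in auto)
      also have "\<dots> = (\<Sum>m'\<in>M. a x m' * int t ^ e m' u)"
        unfolding prod.insert[OF insert.hyps(1,2)] y by (simp add: a_def mult_ac)
      also have "\<dots> = poly q (int t)"
        by (simp add: q_def poly_sum poly_monom)
      finally show ?thesis by simp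
    qed
    then have "int ` {0<..} \<subseteq> {z. poly q z = 0}" by auto
    moreover have "infinite (int ` {0<..})"
      by (simp add: finite_image_iff infinite_Ioi)
    ultimately have "q = 0"
      using poly_roots_finite[of q] finite_subset by blast
    have "(\<Sum>m'\<in>{m' \<in> M. e m' u = ?k}. a x m') = coeff q ?k"
      using insert.prems(1) by (simp add: q_def coeff_sum sum.inter_filter)
    with \<open>q = 0\<close> show ?thesis by simp
  qed
  show ?case
  proof (rule insert.IH[of "{m' \<in> M. e m' u = ?k}"])
    fix m1 m2
    assume "m1 \<in> {m' \<in> M. e m' u = ?k}" "m2 \<in> {m' \<in> M. e m' u = ?k}" "\<forall>v\<in>V. e m1 v = e m2 v"
    then show "m1 = m2" by (intro insert.prems(2)) auto
  qed (use insert.prems slice in \<open>auto simp: a_def\<close>)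
qed

text \<open>
  Two polynomials can be compared only after their sums are taken over common index sets, both of
  monomials and of variables.
\<close>

lemma mpoly_subst_superset:
  assumes "finite K" "Poly_Mapping.keys p \<subseteq> K" "finite V" "\<And>m. m \<in> K \<Longrightarrow> Poly_Mapping.keys m \<subseteq> V"
  shows "mpoly_subst x p =
    (\<Sum>m\<in>K. of_int (Poly_Mapping.lookup p m) * (\<Prod>v\<in>V. x v ^ Poly_Mapping.lookup m v))"
proof -
  have "mpoly_subst x p = (\<Sum>m\<in>K. of_int (Poly_Mapping.lookup p m) *
      (\<Prod>v\<in>Poly_Mapping.keys m. x v ^ Poly_Mapping.lookup m v))"
    unfolding mpoly_subst_def
    by (intro sum.mono_neutral_left assms) (auto simp: in_keys_iff)
  also have "\<dots> = (\<Sum>m\<in>K. of_int (Poly_Mapping.lookup p m) * (\<Prod>v\<in>V. x v ^ Poly_Mapping.lookup m v))"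
    by (intro sum.cong refl arg_cong[of _ _ "\<lambda>y. _ * y"] prod.mono_neutral_left)
      (use assms in \<open>auto simp: in_keys_iff\<close>)
  finally show ?thesis .
qed

lemma int_mpoly_eqI_positives:
  assumes "finite V" and vars: "mpoly_vars p \<subseteq> V" "mpoly_vars q \<subseteq> V"
    and eq: "\<And>x :: 'v \<Rightarrow> nat. (\<forall>v\<in>V. x v > 0) \<Longrightarrow>
      mpoly_subst (\<lambda>v. int (x v)) p = mpoly_subst (\<lambda>v. int (x v)) q"
  shows "p = q"
proof (rule poly_mapping_eqI)
  fix m
  let ?K = "Poly_Mapping.keys p \<union> Poly_Mapping.keys q"
  let ?c = "\<lambda>m. Poly_Mapping.lookup p m - Poly_Mapping.lookup q m"
  have keys: "Poly_Mapping.keys m' \<subseteq> V" if "m' \<in> ?K" for m'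
    using vars that by (auto simp: mpoly_vars_def)
  have zero: "?c m' = 0" if "m' \<in> ?K" for m'
  proof (rule coefficients_eq_0_if_vanishing_on_positives[of V ?K Poly_Mapping.lookup ?c])
    fix m1 m2 assume m: "m1 \<in> ?K" "m2 \<in> ?K"
      and "\<forall>v\<in>V. Poly_Mapping.lookup m1 v = Poly_Mapping.lookup m2 v"
    then show "m1 = m2"
      using keys[OF m(1)] keys[OF m(2)]
      by (intro poly_mapping_eqI) (metis in_keys_iff subsetD)
  next
    fix x :: "'v \<Rightarrow> nat" assume x: "\<forall>v\<in>V. x v > 0"
    show "(\<Sum>m\<in>?K. ?c m * (\<Prod>v\<in>V. int (x v) ^ Poly_Mapping.lookup m v)) = 0"
      using eq[OF x] \<open>finite V\<close> keys
        mpoly_subst_superset[of ?K p V "\<lambda>v. int (x v)"] mpoly_subst_superset[of ?K q V "\<lambda>v. int (x v)"]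
      by (simp add: left_diff_distrib sum_subtractf)
  qed (use \<open>finite V\<close> that in auto)
  show "Poly_Mapping.lookup p m = Poly_Mapping.lookup q m"
    using zero[of m] by (cases "m \<in> ?K") (auto simp: in_keys_iff)
qed

definition squarefree_monomial :: "'v set \<Rightarrow> 'v \<Rightarrow>\<^sub>0 nat" where
  "squarefree_monomial T = (\<Sum>v\<in>T. Poly_Mapping.single v 1)"

text \<open>
  The polynomial with coefficient \<open>c T\<close> at the product of the variables in \<open>T\<close>. Blowup-polynomials
  turn out to have this form.
\<close>

definition multiaffine :: "'v set \<Rightarrow> ('v set \<Rightarrow> int) \<Rightarrow> 'v int_mpoly" where
  "multiaffine V c = (\<Sum>T\<in>Pow V. Poly_Mapping.single (squarefree_monomial T) (c T))"

lemma lookup_squarefree_monomial: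
  "finite T \<Longrightarrow> Poly_Mapping.lookup (squarefree_monomial T) v = (if v \<in> T then 1 else 0)"
  by (simp add: squarefree_monomial_def lookup_sum lookup_single when_def)

lemma keys_squarefree_monomial:
  "finite T \<Longrightarrow> Poly_Mapping.keys (squarefree_monomial T) = T"
  by (auto simp: in_keys_iff lookup_squarefree_monomial split: if_splits)

lemma squarefree_monomial_eq_iff:
  "finite S \<Longrightarrow> finite T \<Longrightarrow> squarefree_monomial S = squarefree_monomial T \<longleftrightarrow> S = T"
  by (metis keys_squarefree_monomial)

lemma lookup_multiaffine:
  assumes "finite V" "T \<subseteq> V"
  shows "Poly_Mapping.lookup (multiaffine V c) (squarefree_monomial T) = c T"
proof -
  have "squarefree_monomial S = squarefree_monomial T \<longleftrightarrow> S = T" if "S \<in> Pow V" for S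
    using that assms by (intro squarefree_monomial_eq_iff) (auto intro: finite_subset)
  then have "Poly_Mapping.lookup (multiaffine V c) (squarefree_monomial T) =
      (\<Sum>S\<in>Pow V. if S = T then c S else 0)"
    unfolding multiaffine_def lookup_sum
    by (intro sum.cong refl) (simp add: lookup_single when_def)
  with assms show ?thesis by simp
qed

lemma keys_multiaffine:
  "Poly_Mapping.keys (multiaffine V c) \<subseteq> squarefree_monomial ` Pow V"
  unfolding multiaffine_def
  by (rule order_trans[OF keys_sum]) (auto split: if_splits)

lemma mpoly_vars_multiaffine:
  assumes "finite V"
  shows "mpoly_vars (multiaffine V c) \<subseteq> V"
  using keys_multiaffine[of V c] assms
  by (fastforce simp: mpoly_vars_def keys_squarefree_monomial finite_subset)

lemma mpoly_subst_multiaffine: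
  assumes "finite V"
  shows "mpoly_subst x (multiaffine V c) = (\<Sum>T\<in>Pow V. of_int (c T) * (\<Prod>v\<in>T. x v))"
proof -
  have fin: "finite T" if "T \<in> Pow V" for T
    using that assms finite_subset by auto
  have "mpoly_subst x (multiaffine V c) =
      (\<Sum>m\<in>squarefree_monomial ` Pow V. of_int (Poly_Mapping.lookup (multiaffine V c) m) *
        (\<Prod>v\<in>Poly_Mapping.keys m. x v ^ Poly_Mapping.lookup m v))"
    unfolding mpoly_subst_def
    by (intro sum.mono_neutral_left keys_multiaffine) (use assms in \<open>auto simp: in_keys_iff\<close>)
  also have "\<dots> = (\<Sum>T\<in>Pow V. of_int (Poly_Mapping.lookup (multiaffine V c) (squarefree_monomial T)) *
        (\<Prod>v\<in>Poly_Mapping.keys (squarefree_monomial T). x v ^ Poly_Mapping.lookup (squarefree_monomial T) v))"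
    by (rule sum.reindex[unfolded o_def])
      (use fin in \<open>auto simp: inj_on_def squarefree_monomial_eq_iff\<close>)
  also have "\<dots> = (\<Sum>T\<in>Pow V. of_int (c T) * (\<Prod>v\<in>T. x v))"
    by (intro sum.cong refl)
      (use assms fin in \<open>auto simp: lookup_multiaffine keys_squarefree_monomial lookup_squarefree_monomial\<close>)
  finally show ?thesis .
qed

lemma prod_indeterminate:
  "finite T \<Longrightarrow> (\<Prod>v\<in>T. indeterminate v) = Poly_Mapping.single (squarefree_monomial T) 1"
  by (induction T rule: finite_induct)
    (simp_all add: indeterminate_def squarefree_monomial_def mult_single)

text \<open>
  The renamed polynomial is described by giving its coefficients \<open>c\<close> at the image sets, which
  avoids the inverse of \<open>\<sigma>\<close> in the statement.
\<close>

lemma mpoly_subst_rename_multiaffine: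
  assumes "finite V" "bij_betw \<sigma> V V" "\<And>T. T \<subseteq> V \<Longrightarrow> c (\<sigma> ` T) = d T"
  shows "mpoly_subst (\<lambda>v. indeterminate (\<sigma> v)) (multiaffine V d) = multiaffine V c"
proof -
  have inj: "inj_on \<sigma> V" and img: "\<sigma> ` V = V"
    using assms(2) by (auto simp: bij_betw_def)
  have "mpoly_subst (\<lambda>v. indeterminate (\<sigma> v)) (multiaffine V d) =
      (\<Sum>T\<in>Pow V. Poly_Mapping.single (squarefree_monomial (\<sigma> ` T)) (c (\<sigma> ` T)))"
    unfolding mpoly_subst_multiaffine[OF assms(1)]
  proof (intro sum.cong refl)
    fix T assume T: "T \<in> Pow V"
    have "finite T" using T assms(1) finite_subset by auto
    moreover have "(\<Prod>v\<in>T. indeterminate (\<sigma> v)) = (\<Prod>v\<in>\<sigma> ` T. indeterminate v)"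
      using T inj by (subst prod.reindex) (auto intro: inj_on_subset)
    ultimately have *: "(\<Prod>v\<in>T. indeterminate (\<sigma> v)) = Poly_Mapping.single (squarefree_monomial (\<sigma> ` T)) 1"
      by (simp add: prod_indeterminate)
    have "(of_int (d T) :: 'a int_mpoly) = Poly_Mapping.single 0 (d T)"
      by (metis single_of_int of_int_eq_id id_apply)
    then show "of_int (d T) * (\<Prod>v\<in>T. indeterminate (\<sigma> v)) =
        Poly_Mapping.single (squarefree_monomial (\<sigma> ` T)) (c (\<sigma> ` T))"
      using T assms(3)[of T] by (simp add: * mult_single)
  qed
  also have "\<dots> = multiaffine V c"
    unfolding multiaffine_def
    by (rule sum.reindex_bij_betw[OF bij_betw_Pow[OF assms(2)]])
  finally show ?thesis .
qed

section \<open>Distances in graphs and in their blowups\<close>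

text \<open>
  Relation powers turn questions about walks into inductions on the length; the blowup and the
  auto-isometries are handled in this form.
\<close>

lemma walk_of_length_iff_relpow:
  assumes "pair_wf_digraph G" "w \<in> pverts G"
  shows "(\<exists>p. pre_digraph.awalk (with_proj G) v p w \<and> length p = k) \<longleftrightarrow> (v, w) \<in> parcs G ^^ k"
proof -
  interpret pair_wf_digraph G by (rule assms)
  show ?thesis
  proof (induction k arbitrary: v)
    case 0
    show ?case using assms(2) by (auto simp: awalk_Nil_iff)
  next
    case (Suc k)
    show ?case
    proof
      assume "\<exists>p. awalk v p w \<and> length p = Suc k"
      then obtain e p where ep: "awalk v (e # p) w" "length p = k"
        by (auto simp: length_Suc_conv)
      then have e: "e \<in> parcs G" "fst e = v" and p: "awalk (snd e) p w"
        by (simp_all add: awalk_Cons_iff)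
      have "(v, snd e) \<in> parcs G" using e by (cases e) auto
      moreover have "(snd e, w) \<in> parcs G ^^ k" using Suc.IH p ep(2) by blast
      ultimately show "(v, w) \<in> parcs G ^^ Suc k" by (rule relpow_Suc_I2)
    next
      assume "(v, w) \<in> parcs G ^^ Suc k"
      then obtain u where u: "(v, u) \<in> parcs G" "(u, w) \<in> parcs G ^^ k"
        by (rule relpow_Suc_E2)
      then obtain p where p: "awalk u p w" "length p = k" using Suc.IH by blast
      with u(1) have "awalk v ((v, u) # p) w" by (simp add: awalk_Cons_iff)
      with p(2) show "\<exists>p. awalk v p w \<and> length p = Suc k"
        by (intro exI[of _ "(v, u) # p"]) simp
    qed
  qed
qed

text \<open>
  Distances are defined through paths without repeated vertices. Cutting the cycles out of a walk
  does not make it longer, so the shortest walk has the length of the shortest such path.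
\<close>

lemma distance_matrix_eq_Least_relpow:
  assumes G: "pair_wf_digraph G" "w \<in> pverts G"
  shows "distance_matrix G v w = (if v = w then 0 else int (LEAST k. (v, w) \<in> parcs G ^^ k))"
proof -
  interpret pair_wf_digraph G by (rule G)
  let ?P = "\<lambda>k. \<exists>p. apath v p w \<and> length p = k" and ?R = "\<lambda>k. (v, w) \<in> parcs G ^^ k"
  have PR: "?R k" if "?P k" for k
    using that walk_of_length_iff_relpow[OF G, of v k] by (auto intro: awalkI_apath)
  have RP: "\<exists>j\<le>k. ?P j" if R: "?R k" for k
  proof -
    obtain p where p: "awalk v p w" "length p = k"
      using R walk_of_length_iff_relpow[OF G, of v k] by auto
    let ?q = "awalk_to_apath p"
    have q: "apath v ?q w" by (rule apath_awalk_to_apath[OF p(1)])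
    \<comment> \<open>A path repeats no arc, so its length is the number of its arcs.\<close>
    then have "distinct ?q"
      by (auto simp: apath_def intro: distinct_verts_imp_distinct)
    then have "length ?q = card (set ?q)" by (simp add: distinct_card)
    also have "\<dots> \<le> card (set p)"
      by (intro card_mono awalk_to_apath_subset[OF p(1)]) simp
    also have "\<dots> \<le> k" using p(2) card_length by blast
    finally show ?thesis using q by blast
  qed
  have "Least ?P = Least ?R"
  proof (cases "\<exists>k. ?R k")
    case True
    then have "?R (Least ?R)" by (rule LeastI_ex)
    then obtain j where j: "j \<le> Least ?R" "?P j" using RP by blast
    have "?P (Least ?P)" using j(2) by (rule LeastI)
    from Least_le[of ?R, OF PR[OF this]] Least_le[of ?P, OF j(2)] j(1)
    show ?thesis by simp
  next
    case False
    with PR have "?P = ?R" by blast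
    then show ?thesis by simp
  qed
  then show ?thesis by (simp add: distance_matrix_def)
qed

lemma simple_connected_graph_walk_exists:
  assumes "simple_connected_graph G" "v \<in> pverts G" "w \<in> pverts G"
  shows "\<exists>k. (v, w) \<in> parcs G ^^ k"
proof -
  interpret pair_graph G using assms(1) by (simp add: simple_connected_graph_def)
  have "strongly_connected (with_proj G)"
    using assms(1) symmetric_connected_imp_strongly_connected[OF sym_arcs]
    by (simp add: simple_connected_graph_def)
  then have "v \<rightarrow>\<^sup>*\<^bsub>with_proj G\<^esub> w"
    using assms(2,3) by (auto simp: strongly_connected_def)
  then show ?thesis
    using walk_of_length_iff_relpow[OF _ assms(3), of v] pair_wf_digraph by (auto simp: reachable_awalk)
qed

lemma distance_matrix_eq_1_iff:
  assumes G: "simple_connected_graph G" and vw: "v \<in> pverts G" "w \<in> pverts G"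
  shows "distance_matrix G v w = 1 \<longleftrightarrow> (v, w) \<in> parcs G"
proof -
  interpret pair_graph G using G by (simp add: simple_connected_graph_def)
  let ?R = "\<lambda>k. (v, w) \<in> parcs G ^^ k"
  show ?thesis
  proof (cases "v = w")
    case True
    then show ?thesis using no_loops' by (auto simp: distance_matrix_def)
  next
    case False
    have "?R (Least ?R)"
      using simple_connected_graph_walk_exists[OF assms] by (rule LeastI_ex)
    moreover have "Least ?R = 1" if "?R 1"
      using that False by (intro Least_equality) (auto simp: Suc_le_eq intro: gr0I)
    ultimately have "Least ?R = 1 \<longleftrightarrow> ?R 1" by metis
    then show ?thesis
      using False by (simp add: distance_matrix_eq_Least_relpow[OF pair_wf_digraph vw(2)])
  qed
qed

lemma distance_matrix_nonneg: "distance_matrix G v w \<ge> 0"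
  by (simp add: distance_matrix_def)

lemma distance_matrix_eq_2:
  assumes "pair_wf_digraph G" "v \<noteq> w" "(v, w) \<notin> parcs G" "(v, u) \<in> parcs G" "(u, w) \<in> parcs G"
  shows "distance_matrix G v w = 2"
proof -
  interpret pair_wf_digraph G by (rule assms)
  let ?R = "\<lambda>k. (v, w) \<in> parcs G ^^ k"
  have "?R 2" using assms(4,5) by (auto simp: numeral_2_eq_2)
  moreover have "2 \<le> k" if "?R k" for k
  proof -
    have "k \<noteq> 0" using that assms(2) by (intro notI) simp
    moreover have "k \<noteq> 1" using that assms(3) by (intro notI) simp
    ultimately show ?thesis by simp
  qed
  ultimately have "Least ?R = 2" by (rule Least_equality)
  with assms(2) show ?thesis
    by (simp add: distance_matrix_eq_Least_relpow[OF assms(1) in_arcsD2[OF assms(5)]])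
qed

text \<open>
  An auto-isometry maps walks to walks, and every walk between image vertices arises in this way
  because \<open>\<sigma>\<close> is onto the vertices.
\<close>

lemma distance_matrix_auto_isometry:
  assumes "pair_wf_digraph G" "auto_isometry G \<sigma>" "v \<in> pverts G" "w \<in> pverts G"
  shows "distance_matrix G (\<sigma> v) (\<sigma> w) = distance_matrix G v w"
proof -
  interpret pair_wf_digraph G by (rule assms)
  let ?V = "pverts G"
  have bij: "bij_betw \<sigma> ?V ?V"
    and arcs: "\<And>x y. x \<in> ?V \<Longrightarrow> y \<in> ?V \<Longrightarrow> (\<sigma> x, \<sigma> y) \<in> parcs G \<longleftrightarrow> (x, y) \<in> parcs G"
    using assms(2) by (auto simp: auto_isometry_def)
  have walks: "(\<sigma> v, \<sigma> w) \<in> parcs G ^^ k \<longleftrightarrow> (v, w) \<in> parcs G ^^ k" for k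
    using assms(4)
  proof (induction k arbitrary: w)
    case 0
    then show ?case
      using bij assms(3) by (auto simp: bij_betw_def dest: inj_onD)
  next
    case (Suc k)
    have "(\<sigma> v, \<sigma> w) \<in> parcs G ^^ Suc k \<longleftrightarrow>
        (\<exists>u\<in>?V. (\<sigma> v, u) \<in> parcs G ^^ k \<and> (u, \<sigma> w) \<in> parcs G)"
      by (auto dest: in_arcsD1)
    also have "\<dots> \<longleftrightarrow> (\<exists>u\<in>\<sigma> ` ?V. (\<sigma> v, u) \<in> parcs G ^^ k \<and> (u, \<sigma> w) \<in> parcs G)"
      using bij by (simp only: bij_betw_def)
    also have "\<dots> \<longleftrightarrow> (\<exists>u\<in>?V. (\<sigma> v, \<sigma> u) \<in> parcs G ^^ k \<and> (\<sigma> u, \<sigma> w) \<in> parcs G)"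
      by blast
    also have "\<dots> \<longleftrightarrow> (\<exists>u\<in>?V. (v, u) \<in> parcs G ^^ k \<and> (u, w) \<in> parcs G)"
      using Suc arcs by blast
    also have "\<dots> \<longleftrightarrow> (v, w) \<in> parcs G ^^ Suc k"
      by (auto dest: in_arcsD1)
    finally show ?case .
  qed
  have eq: "\<sigma> v = \<sigma> w \<longleftrightarrow> v = w" and "\<sigma> w \<in> ?V"
    using bij assms(3,4) by (auto simp: bij_betw_def dest: inj_onD)
  then show ?thesis
    using assms by (simp add: distance_matrix_eq_Least_relpow walks)
qed

lemma pair_wf_digraph_blowup:
  assumes "pair_wf_digraph G"
  shows "pair_wf_digraph (blowup G n)"
proof -
  interpret pair_wf_digraph G by (rule assms)
  show ?thesis by unfold_locales (auto simp: blowup_def dest: in_arcsD1 in_arcsD2)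
qed

text \<open>
  Forgetting the copies projects a walk of the blowup to \<open>G\<close>. Conversely a walk lifts with
  prescribed copies at its ends, using the copy 0 of every vertex in between; positivity of \<open>n\<close>
  guarantees that this copy exists. A walk between different vertices has positive length, so its
  two ends can be chosen independently.
\<close>

lemma relpow_blowup_iff:
  assumes "pair_wf_digraph G" "\<And>e. e \<in> parcs G \<Longrightarrow> fst e \<noteq> snd e" "\<forall>v\<in>pverts G. n v > 0"
    and "v \<noteq> w" "i < n v" "j < n w"
  shows "((v, i), (w, j)) \<in> parcs (blowup G n) ^^ k \<longleftrightarrow> (v, w) \<in> parcs G ^^ k"
proof
  have "(fst x, fst y) \<in> parcs G ^^ k" if "(x, y) \<in> parcs (blowup G n) ^^ k" for x y
    using that
  proof (induction k arbitrary: y)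
    case (Suc k)
    then show ?case by (fastforce simp: blowup_def)
  qed simp
  from this[of "(v, i)" "(w, j)"]
  show "((v, i), (w, j)) \<in> parcs (blowup G n) ^^ k \<Longrightarrow> (v, w) \<in> parcs G ^^ k" by simp
next
  interpret pair_wf_digraph G by (rule assms)
  \<comment> \<open>Only the length 0 would force the copies \<open>i\<close> and \<open>j\<close> to agree.\<close>
  have lift: "((v, i), (w, j)) \<in> parcs (blowup G n) ^^ Suc k"
    if "(v, w) \<in> parcs G ^^ Suc k" "j < n w" for k w j
    using that
  proof (induction k arbitrary: w j)
    case 0
    then show ?case using assms(2)[of "(v, w)"] assms(5) by (auto simp: blowup_def)
  next
    case (Suc k)
    then obtain u where u: "(v, u) \<in> parcs G ^^ Suc k" "(u, w) \<in> parcs G" by (metis relpow_Suc_E)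
    then have "n u > 0" using assms(3) in_arcsD1 by auto
    with Suc.IH[OF u(1)] have "((v, i), (u, 0)) \<in> parcs (blowup G n) ^^ Suc k" .
    moreover have "((u, 0), (w, j)) \<in> parcs (blowup G n)"
      using u(2) Suc.prems(2) \<open>n u > 0\<close> assms(2)[of "(u, w)"] by (auto simp: blowup_def)
    ultimately show ?case by (rule relpow_Suc_I)
  qed
  assume "(v, w) \<in> parcs G ^^ k"
  with lift assms show "((v, i), (w, j)) \<in> parcs (blowup G n) ^^ k" by (cases k) auto
qed

lemma simple_connected_graph_has_neighbour:
  assumes "simple_connected_graph G" "card (pverts G) \<ge> 2" "v \<in> pverts G"
  shows "\<exists>u. (v, u) \<in> parcs G"
proof -
  have "\<not> pverts G \<subseteq> {v}"
    using assms(2) card_mono[of "{v}" "pverts G"] by auto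
  then obtain w where w: "w \<in> pverts G" "w \<noteq> v" by auto
  then obtain k where k: "(v, w) \<in> parcs G ^^ k"
    using simple_connected_graph_walk_exists[OF assms(1,3)] by blast
  with w(2) obtain j where "k = Suc j" by (cases k) auto
  with k show ?thesis by (blast elim: relpow_Suc_E2)
qed

text \<open>
  The right-hand side is the repeated modified distance matrix minus twice the identity: the
  correction 2 for copies of the same vertex is their actual distance, and it is cancelled when the
  two copies coincide.
\<close>

lemma distance_matrix_blowup:
  assumes G: "simple_connected_graph G" "card (pverts G) \<ge> 2" and n: "\<forall>v\<in>pverts G. n v > 0"
    and x: "x \<in> pverts (blowup G n)" and y: "y \<in> pverts (blowup G n)"
  shows "distance_matrix (blowup G n) x y =
    distance_matrix G (fst x) (fst y) + (if fst x = fst y then 2 else 0) + (if x = y then - 2 else 0)"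
proof -
  interpret pair_graph G using G by (simp add: simple_connected_graph_def)
  obtain v i w j where xy: "x = (v, i)" "y = (w, j)" by fastforce
  with x y have v: "v \<in> pverts G" "i < n v" and w: "w \<in> pverts G" "j < n w"
    by (auto simp: blowup_def)
  note wf = pair_wf_digraph_blowup[OF pair_wf_digraph]
  consider "v \<noteq> w" | "v = w" "i \<noteq> j" | "x = y" using xy by auto
  then show ?thesis
  proof cases
    case 1
    have "\<And>k. ((v, i), (w, j)) \<in> parcs (blowup G n) ^^ k \<longleftrightarrow> (v, w) \<in> parcs G ^^ k"
      by (intro relpow_blowup_iff pair_wf_digraph n no_loops 1 v w)
    with 1 show ?thesis
      using y by (simp add: xy distance_matrix_eq_Least_relpow[OF wf]
          distance_matrix_eq_Least_relpow[OF pair_wf_digraph w(1)])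
  next
    case 2
    obtain u where u: "(v, u) \<in> parcs G"
      using simple_connected_graph_has_neighbour[OF G v(1)] by blast
    have "distance_matrix (blowup G n) x y = 2"
    proof (rule distance_matrix_eq_2[OF wf])
      show "(x, (u, 0)) \<in> parcs (blowup G n)" "((u, 0), y) \<in> parcs (blowup G n)"
        using u n v w 2 no_loops' arcs_symmetric in_arcsD2[OF u] by (auto simp: xy blowup_def)
    qed (use 2 in \<open>auto simp: xy blowup_def\<close>)
    with 2 show ?thesis by (simp add: xy distance_matrix_def)
  next
    case 3
    then show ?thesis by (simp add: distance_matrix_def)
  qed
qed

section \<open>The explicit blowup-polynomial\<close>

text \<open>
  A set that meets each fibre over \<open>T\<close> exactly once, and no other fibre, is the graph of a choice
  of one copy for each vertex in \<open>T\<close>.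
\<close>

lemma card_sections:
  assumes "finite V" "T \<subseteq> V"
  shows "card {S \<in> Pow (SIGMA v : V. {..<n v}). inj_on fst S \<and> fst ` S = T} = (\<Prod>v\<in>T. n v)"
proof -
  have "finite T" using assms finite_subset by auto
  let ?graph = "\<lambda>g. (\<lambda>v. (v, g v)) ` T"
  let ?C = "{S \<in> Pow (SIGMA v : V. {..<n v}). inj_on fst S \<and> fst ` S = T}"
  have "bij_betw ?graph (\<Pi>\<^sub>E v\<in>T. {..<n v}) ?C"
  proof (rule bij_betw_imageI)
    show "inj_on ?graph (\<Pi>\<^sub>E v\<in>T. {..<n v})"
    proof (rule inj_onI)
      fix g h assume gh: "g \<in> (\<Pi>\<^sub>E v\<in>T. {..<n v})" "h \<in> (\<Pi>\<^sub>E v\<in>T. {..<n v})"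
        and eq: "?graph g = ?graph h"
      show "g = h"
      proof (rule PiE_ext[OF gh])
        fix v assume "v \<in> T"
        then have "(v, g v) \<in> ?graph h" unfolding eq[symmetric] by blast
        then show "g v = h v" by auto
      qed
    qed
    show "?graph ` (\<Pi>\<^sub>E v\<in>T. {..<n v}) = ?C"
    proof (intro equalityI subsetI)
      fix S assume "S \<in> ?graph ` (\<Pi>\<^sub>E v\<in>T. {..<n v})"
      then obtain g where "S = ?graph g" "g \<in> (\<Pi>\<^sub>E v\<in>T. {..<n v})" by blast
      then show "S \<in> ?C"
        using assms(2) by (auto simp: inj_on_def image_image dest: PiE_mem)
    next
      fix S assume S: "S \<in> ?C"
      define g where "g = restrict (\<lambda>v. SOME i. (v, i) \<in> S) T"
      have g: "(v, g v) \<in> S" if "v \<in> T" for v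
      proof -
        have "\<exists>i. (v, i) \<in> S" using S that by auto
        then have "(v, SOME i. (v, i) \<in> S) \<in> S" by (rule someI_ex)
        with that show ?thesis by (simp add: g_def)
      qed
      have "S = ?graph g"
      proof (intro equalityI subsetI)
        fix x assume x: "x \<in> S"
        then have "fst x \<in> T" using S by auto
        with S x g[of "fst x"] have "x = (fst x, g (fst x))"
          by (metis (mono_tags, lifting) fst_conv inj_onD mem_Collect_eq)
        with \<open>fst x \<in> T\<close> show "x \<in> ?graph g" by blast
      qed (use g in auto)
      moreover have "g \<in> (\<Pi>\<^sub>E v\<in>T. {..<n v})"
      proof (rule PiE_I)
        fix v assume "v \<in> T"
        then show "g v \<in> {..<n v}" using g S by auto
      qed (simp add: g_def)
      ultimately show "S \<in> ?graph ` (\<Pi>\<^sub>E v\<in>T. {..<n v})" by blast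
    qed
  qed
  then have "card ?C = card (\<Pi>\<^sub>E v\<in>T. {..<n v})" by (rule bij_betw_same_card[symmetric])
  with \<open>finite T\<close> show ?thesis by (simp add: card_PiE)
qed

text \<open>
  The determinant of a matrix with repeated indices, shifted by a scalar matrix. In the expansion
  into principal minors, a minor containing two copies of an index vanishes; the others are grouped
  by the set \<open>T\<close> of indices that they involve.
\<close>

lemma set_det_duplicated_indices:
  assumes V: "finite V" and n: "\<forall>v\<in>V. n v > 0"
  shows "set_det (SIGMA v : V. {..<n v}) (\<lambda>x y. A (fst x) (fst y) + (if x = y then c else 0)) =
    c ^ (\<Sum>v\<in>V. n v - 1) *
      (\<Sum>T\<in>Pow V. c ^ (card V - card T) * set_det T A * (\<Prod>v\<in>T. int (n v)))"
proof -
  let ?N = "SIGMA v : V. {..<n v}" and ?B = "\<lambda>x y. A (fst x) (fst y)"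
  let ?I = "{S \<in> Pow ?N. inj_on fst S}"
  have N: "finite ?N" using V by auto
  then have fin: "finite S" if "S \<in> Pow ?N" for S using that finite_subset by auto
  have "card ?N = (\<Sum>v\<in>V. (n v - 1) + 1)"
    using V n by (auto simp: card_SigmaI intro!: sum.cong)
  then have cardN: "card ?N = (\<Sum>v\<in>V. n v - 1) + card V"
    by (simp only: sum.distrib sum_constant)
      simp
  have "set_det ?N (\<lambda>x y. ?B x y + (if x = y then c else 0)) =
      (\<Sum>S\<in>Pow ?N. c ^ (card ?N - card S) * set_det S ?B)"
    by (rule set_det_add_scalar[OF N])
  also have "\<dots> = (\<Sum>S\<in>?I. c ^ (card ?N - card S) * set_det S ?B)"
    by (rule sum.mono_neutral_right)
      (use N fin in \<open>auto simp: set_det_eq_0_if_not_inj\<close>)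
  also have "\<dots> = (\<Sum>S\<in>?I. c ^ (card ?N - card (fst ` S)) * set_det (fst ` S) A)"
    by (intro sum.cong refl) (simp add: card_image set_det_reindex fin)
  also have "\<dots> = (\<Sum>T\<in>Pow V. \<Sum>S\<in>{S \<in> ?I. fst ` S = T}.
      c ^ (card ?N - card (fst ` S)) * set_det (fst ` S) A)"
    by (rule sum.group[symmetric]) (use N V in auto)
  also have "\<dots> = (\<Sum>T\<in>Pow V. int (\<Prod>v\<in>T. n v) * (c ^ (card ?N - card T) * set_det T A))"
  proof (intro sum.cong refl)
    fix T assume T: "T \<in> Pow V"
    have "{S \<in> ?I. fst ` S = T} = {S \<in> Pow ?N. inj_on fst S \<and> fst ` S = T}" by auto
    then have "card {S \<in> ?I. fst ` S = T} = (\<Prod>v\<in>T. n v)"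
      using card_sections[OF V, of T n] T by auto
    then show "(\<Sum>S\<in>{S \<in> ?I. fst ` S = T}. c ^ (card ?N - card (fst ` S)) * set_det (fst ` S) A) =
        int (\<Prod>v\<in>T. n v) * (c ^ (card ?N - card T) * set_det T A)"
      by simp
  qed
  also have "\<dots> = c ^ (\<Sum>v\<in>V. n v - 1) *
      (\<Sum>T\<in>Pow V. c ^ (card V - card T) * set_det T A * (\<Prod>v\<in>T. int (n v)))"
    unfolding sum_distrib_left
  proof (intro sum.cong refl)
    fix T assume "T \<in> Pow V"
    then have "card T \<le> card V" using V by (auto intro: card_mono)
    then have "card ?N - card T = (\<Sum>v\<in>V. n v - 1) + (card V - card T)"
      by (simp add: cardN)
    then show "int (\<Prod>v\<in>T. n v) * (c ^ (card ?N - card T) * set_det T A) =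
        c ^ (\<Sum>v\<in>V. n v - 1) * (c ^ (card V - card T) * set_det T A * (\<Prod>v\<in>T. int (n v)))"
      by (simp add: power_add)
  qed
  finally show ?thesis .
qed

text \<open>
  The diagonal entry 2 is the distance between two different copies of a vertex in a blowup.
\<close>

definition modified_distance :: "'a pair_pre_digraph \<Rightarrow> 'a \<Rightarrow> 'a \<Rightarrow> int" where
  "modified_distance G v w = distance_matrix G v w + (if v = w then 2 else 0)"

definition blowup_coefficient :: "'a pair_pre_digraph \<Rightarrow> 'a set \<Rightarrow> int" where
  "blowup_coefficient G T = (- 2) ^ (card (pverts G) - card T) * set_det T (modified_distance G)"

lemma set_det_distance_matrix_blowup:
  assumes G: "simple_connected_graph G" "card (pverts G) \<ge> 2" and n: "\<forall>v\<in>pverts G. n v > 0"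
  shows "set_det (pverts (blowup G n)) (distance_matrix (blowup G n)) =
    (- 2) ^ (\<Sum>v\<in>pverts G. n v - 1) *
      (\<Sum>T\<in>Pow (pverts G). blowup_coefficient G T * (\<Prod>v\<in>T. int (n v)))"
proof -
  have V: "finite (pverts G)"
    using G(2) by (auto intro: card_ge_0_finite)
  have N: "pverts (blowup G n) = (SIGMA v : pverts G. {..<n v})"
    by (simp add: blowup_def)
  have "set_det (pverts (blowup G n)) (distance_matrix (blowup G n)) =
      set_det (pverts (blowup G n))
        (\<lambda>x y. modified_distance G (fst x) (fst y) + (if x = y then - 2 else 0))"
    by (rule set_det_cong)
      (simp add: distance_matrix_blowup[OF G n] modified_distance_def)
  then show ?thesis
    by (simp add: N set_det_duplicated_indices[OF V n] blowup_coefficient_def)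
qed

lemma blowup_polynomial_eq:
  assumes G: "simple_connected_graph G" "card (pverts G) \<ge> 2"
  shows "blowup_polynomial G = multiaffine (pverts G) (blowup_coefficient G)"
  unfolding blowup_polynomial_def
proof (rule the_equality)
  let ?V = "pverts G" and ?p = "multiaffine (pverts G) (blowup_coefficient G)"
  have V: "finite ?V"
    using G(2) by (auto intro: card_ge_0_finite)
  show p: "is_blowup_polynomial G ?p"
    by (simp add: is_blowup_polynomial_def mpoly_vars_multiaffine[OF V]
        set_det_distance_matrix_blowup[OF G] mpoly_subst_multiaffine[OF V])
  fix q assume "is_blowup_polynomial G q"
  with p show "q = ?p"
    by (intro int_mpoly_eqI_positives[OF V]) (auto simp: is_blowup_polynomial_def)
qed

section \<open>Recovering the graph and its symmetries\<close>

text \<open>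
  The 4 is the product of the two diagonal entries; the subtracted product is the square of the
  distance, which is what makes the coefficient reveal the distance.
\<close>

lemma blowup_coefficient_pair:
  assumes "v \<noteq> w"
  shows "blowup_coefficient G {v, w} =
    (- 2) ^ (card (pverts G) - 2) * (4 - distance_matrix G v w * distance_matrix G w v)"
  using assms
  by (simp add: blowup_coefficient_def set_det_doubleton modified_distance_def)
    (simp add: distance_matrix_def numeral_2_eq_2)

text \<open>
  Distances are nonnegative integers, so the product of the two distances between \<open>v\<close> and \<open>w\<close> is 1
  exactly when both are 1, that is, when \<open>v\<close> and \<open>w\<close> are adjacent. The statement relates vertex
  pairs of two graphs so that it serves both the recovery of the graph and its symmetries.
\<close>

lemma adjacent_iff_of_blowup_coefficient_eq:
  assumes G: "simple_connected_graph G" and H: "simple_connected_graph H"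
    and "card (pverts G) = card (pverts H)"
    and vw: "v \<in> pverts G" "w \<in> pverts G" and vw': "v' \<in> pverts H" "w' \<in> pverts H"
    and "v = w \<longleftrightarrow> v' = w'" and eq: "blowup_coefficient G {v, w} = blowup_coefficient H {v', w'}"
  shows "(v, w) \<in> parcs G \<longleftrightarrow> (v', w') \<in> parcs H"
proof (cases "v = w")
  case True
  then have "distance_matrix G v w \<noteq> 1" "distance_matrix H v' w' \<noteq> 1"
    using assms(8) by (auto simp: distance_matrix_def)
  then show ?thesis
    using distance_matrix_eq_1_iff[OF G vw] distance_matrix_eq_1_iff[OF H vw'] by blast
next
  case False
  have adj: "distance_matrix K x y * distance_matrix K y x = 1 \<longleftrightarrow> (x, y) \<in> parcs K"
    if K: "simple_connected_graph K" and xy: "x \<in> pverts K" "y \<in> pverts K" for K :: "'x pair_pre_digraph" and x y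
  proof -
    interpret pair_graph K using K by (simp add: simple_connected_graph_def)
    have "distance_matrix K x y * distance_matrix K y x = 1 \<longleftrightarrow>
        distance_matrix K x y = 1 \<and> distance_matrix K y x = 1"
      using distance_matrix_nonneg[of K x y] by (auto simp: zmult_eq_1_iff)
    then show ?thesis
      using distance_matrix_eq_1_iff[OF K] xy arcs_symmetric by auto
  qed
  from eq False assms(3,8) have "distance_matrix G v w * distance_matrix G w v =
      distance_matrix H v' w' * distance_matrix H w' v'"
    by (simp add: blowup_coefficient_pair)
  then show ?thesis
    using adj[OF G vw] adj[OF H vw'] by metis
qed

lemma blowup_polynomial_inj:
  assumes G: "simple_connected_graph G" and H: "simple_connected_graph H"
    and V: "pverts G = pverts H" "card (pverts G) \<ge> 2"
    and eq: "blowup_polynomial G = blowup_polynomial H"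
  shows "G = H"
proof -
  interpret G: pair_graph G using G by (simp add: simple_connected_graph_def)
  interpret H: pair_graph H using H by (simp add: simple_connected_graph_def)
  have mult: "multiaffine (pverts G) (blowup_coefficient G) = multiaffine (pverts G) (blowup_coefficient H)"
    using eq V G H by (simp add: blowup_polynomial_eq)
  have coeff: "blowup_coefficient G T = blowup_coefficient H T" if "T \<subseteq> pverts G" for T
    by (metis G.pair_finite_verts lookup_multiaffine mult that)
  have adj: "(v, w) \<in> parcs G \<longleftrightarrow> (v, w) \<in> parcs H" if "v \<in> pverts G" "w \<in> pverts G" for v w
    by (rule adjacent_iff_of_blowup_coefficient_eq[OF G H]) (use that V coeff in auto)
  have "parcs G = parcs H"
  proof (intro equalityI subrelI)
    fix v w assume "(v, w) \<in> parcs G"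
    then show "(v, w) \<in> parcs H" using adj G.in_arcsD1 G.in_arcsD2 by blast
  next
    fix v w assume "(v, w) \<in> parcs H"
    then show "(v, w) \<in> parcs G" using adj[of v w] H.in_arcsD1 H.in_arcsD2 V(1) by blast
  qed
  with V(1) show ?thesis by simp
qed

lemma blowup_polynomial_symmetry_iff:
  assumes G: "simple_connected_graph G" "card (pverts G) \<ge> 2"
    and \<sigma>: "bij_betw \<sigma> (pverts G) (pverts G)"
  shows "mpoly_subst (\<lambda>v. indeterminate (\<sigma> v)) (blowup_polynomial G) = blowup_polynomial G \<longleftrightarrow>
    auto_isometry G \<sigma>"
proof -
  interpret pair_graph G using G by (simp add: simple_connected_graph_def)
  let ?V = "pverts G" and ?c = "blowup_coefficient G"
  have inj: "inj_on \<sigma> ?V" and img: "\<sigma> ` ?V = ?V"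
    using \<sigma> by (auto simp: bij_betw_def)
  \<comment> \<open>The coefficients of the renamed polynomial are those of \<open>p_G\<close> at the preimages under \<open>\<sigma>\<close>.\<close>
  define \<tau> where "\<tau> = the_inv_into ?V \<sigma>"
  have \<tau>: "\<tau> ` \<sigma> ` T = T" if "T \<subseteq> ?V" for T
    using that the_inv_into_f_f[OF inj] by (force simp: \<tau>_def image_image)
  have renamed: "mpoly_subst (\<lambda>v. indeterminate (\<sigma> v)) (blowup_polynomial G) =
      multiaffine ?V (\<lambda>T. ?c (\<tau> ` T))"
    unfolding blowup_polynomial_eq[OF G]
    by (rule mpoly_subst_rename_multiaffine[OF pair_finite_verts \<sigma>]) (simp add: \<tau>)
  show ?thesis
  proof
    assume "mpoly_subst (\<lambda>v. indeterminate (\<sigma> v)) (blowup_polynomial G) = blowup_polynomial G"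
    with renamed have mult: "multiaffine ?V (\<lambda>T. ?c (\<tau> ` T)) = multiaffine ?V ?c"
      by (simp only: blowup_polynomial_eq[OF G])
    have coeff: "?c T = ?c (\<sigma> ` T)" if T: "T \<subseteq> ?V" for T
    proof -
      have "\<sigma> ` T \<subseteq> ?V" using T img by auto
      from lookup_multiaffine[OF pair_finite_verts this, of "\<lambda>T. ?c (\<tau> ` T)"]
        lookup_multiaffine[OF pair_finite_verts this, of ?c]
      show ?thesis by (simp add: mult \<tau>[OF T])
    qed
    have "(\<sigma> v, \<sigma> w) \<in> parcs G \<longleftrightarrow> (v, w) \<in> parcs G" if vw: "v \<in> ?V" "w \<in> ?V" for v w
    proof (rule adjacent_iff_of_blowup_coefficient_eq[OF G(1) G(1)])
      show "\<sigma> v = \<sigma> w \<longleftrightarrow> v = w" using inj vw by (auto dest: inj_onD)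
      show "?c {\<sigma> v, \<sigma> w} = ?c {v, w}" using coeff[of "{v, w}"] vw by simp
    qed (use vw img in auto)
    with \<sigma> show "auto_isometry G \<sigma>" by (simp add: auto_isometry_def)
  next
    assume iso: "auto_isometry G \<sigma>"
    have "?c T = ?c (\<sigma> ` T)" if T: "T \<subseteq> ?V" for T
    proof -
      have injT: "inj_on \<sigma> T" and finT: "finite T"
        using inj T inj_on_subset pair_finite_verts finite_subset by blast+
      have "set_det (\<sigma> ` T) (modified_distance G) =
          set_det T (\<lambda>v w. modified_distance G (\<sigma> v) (\<sigma> w))"
        by (rule set_det_reindex[symmetric, OF finT injT])
      also have "\<dots> = set_det T (modified_distance G)"
      proof (rule set_det_cong)
        fix v w assume "v \<in> T" "w \<in> T"
        with T have "v \<in> ?V" "w \<in> ?V" by auto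
        then show "modified_distance G (\<sigma> v) (\<sigma> w) = modified_distance G v w"
          using inj distance_matrix_auto_isometry[OF pair_wf_digraph iso]
          by (auto simp: modified_distance_def dest: inj_onD)
      qed
      finally show ?thesis
        by (simp add: blowup_coefficient_def card_image[OF injT])
    qed
    then show "mpoly_subst (\<lambda>v. indeterminate (\<sigma> v)) (blowup_polynomial G) = blowup_polynomial G"
      unfolding blowup_polynomial_eq[OF G]
      by (intro mpoly_subst_rename_multiaffine[OF pair_finite_verts \<sigma>]) simp
  qed
qed

section \<open>Graphs with the same univariate blowup-polynomial\<close>

lemma poly_univariate_blowup_polynomial:
  assumes G: "simple_connected_graph G" "card (pverts G) \<ge> 2"
  shows "poly (univariate_blowup_polynomial G) t =
    set_det (pverts G) (\<lambda>v w. t * modified_distance G v w + (if v = w then - 2 else 0))"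
proof -
  have V: "finite (pverts G)"
    using G(2) by (auto intro: card_ge_0_finite)
  have "poly (univariate_blowup_polynomial G) t =
      (\<Sum>T\<in>Pow (pverts G). blowup_coefficient G T * t ^ card T)"
    by (simp add: univariate_blowup_polynomial_def blowup_polynomial_eq[OF G]
        mpoly_subst_multiaffine[OF V] poly_sum)
  also have "\<dots> = (\<Sum>T\<in>Pow (pverts G). (- 2) ^ (card (pverts G) - card T) *
      set_det T (\<lambda>v w. t * modified_distance G v w))"
    by (simp add: set_det_scale blowup_coefficient_def mult_ac)
  also have "\<dots> = set_det (pverts G) (\<lambda>v w. t * modified_distance G v w + (if v = w then - 2 else 0))"
    by (rule set_det_add_scalar[OF V, symmetric])
  finally show ?thesis .
qed

text \<open>
  Matrices that are intertwined by an invertible \<open>Q\<close> remain so after scaling by \<open>t\<close> and subtracting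
  a multiple of the identity. Taking determinants, the nonzero factor \<open>det Q\<close> cancels. Working with
  an intertwiner instead of a conjugation keeps all entries integral.
\<close>

lemma univariate_blowup_polynomial_eqI:
  assumes G: "simple_connected_graph G" and H: "simple_connected_graph H"
    and V: "pverts G = V" "pverts H = V" "card V \<ge> 2"
    and Q: "set_det V Q \<noteq> 0"
    and intertwine: "\<And>i j. i \<in> V \<Longrightarrow> j \<in> V \<Longrightarrow>
      (\<Sum>k\<in>V. Q i k * modified_distance G k j) = (\<Sum>k\<in>V. modified_distance H i k * Q k j)"
  shows "univariate_blowup_polynomial G = univariate_blowup_polynomial H"
proof (rule poly_ext)
  fix t :: int
  have fin: "finite V" using V(3) by (auto intro: card_ge_0_finite)
  let ?A = "\<lambda>v w. t * modified_distance G v w + (if v = w then - 2 else 0)"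
  let ?B = "\<lambda>v w. t * modified_distance H v w + (if v = w then - 2 else 0)"
  have "set_det V Q * set_det V ?A = set_det V (\<lambda>i j. \<Sum>k\<in>V. Q i k * ?A k j)"
    by (rule set_det_mult[OF fin, symmetric])
  also have "\<dots> = set_det V (\<lambda>i j. \<Sum>k\<in>V. ?B i k * Q k j)"
  proof (rule set_det_cong)
    fix i j assume ij: "i \<in> V" "j \<in> V"
    have left: "Q i k * ?A k j = t * (Q i k * modified_distance G k j) + (if k = j then - 2 * Q i j else 0)" for k
      by (simp add: algebra_simps)
    have right: "?B i k * Q k j = t * (modified_distance H i k * Q k j) + (if i = k then - 2 * Q i j else 0)" for k
      by (simp add: algebra_simps)
    have "(\<Sum>k\<in>V. Q i k * ?A k j) = t * (\<Sum>k\<in>V. Q i k * modified_distance G k j) - 2 * Q i j"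
      unfolding left sum.distrib sum_distrib_left[symmetric] using ij fin by simp
    also have "\<dots> = t * (\<Sum>k\<in>V. modified_distance H i k * Q k j) - 2 * Q i j"
      by (simp add: intertwine[OF ij])
    also have "\<dots> = (\<Sum>k\<in>V. ?B i k * Q k j)"
      unfolding right sum.distrib sum_distrib_left[symmetric] using ij fin by simp
    finally show "(\<Sum>k\<in>V. Q i k * ?A k j) = (\<Sum>k\<in>V. ?B i k * Q k j)" .
  qed
  also have "\<dots> = set_det V ?B * set_det V Q"
    by (rule set_det_mult[OF fin])
  finally have "set_det V ?A = set_det V ?B" using Q by simp
  with G H V show "poly (univariate_blowup_polynomial G) t = poly (univariate_blowup_polynomial H) t"
    by (simp add: poly_univariate_blowup_polynomial)
qed

lemma diameter_two_simple_connected: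
  assumes "pair_graph G" "pverts G \<noteq> {}"
    and diam: "\<And>v w. v \<in> pverts G \<Longrightarrow> w \<in> pverts G \<Longrightarrow> v \<noteq> w \<Longrightarrow>
      (v, w) \<in> parcs G \<or> (\<exists>u. (v, u) \<in> parcs G \<and> (u, w) \<in> parcs G)"
  shows "simple_connected_graph G"
proof -
  interpret pair_graph G by (rule assms)
  have "(v, w) \<in> rtrancl_on (pverts G) ((parcs G)\<^sup>s)"
    if vw: "v \<in> pverts G" "w \<in> pverts G" for v w
  proof -
    let ?R = "rtrancl_on (pverts G) ((parcs G)\<^sup>s)"
    have step: "(v, y) \<in> ?R" if "(v, x) \<in> ?R" "(x, y) \<in> parcs G" for x y
      using that in_arcsD2 by (auto intro: rtrancl_on_into_rtrancl_on simp: symcl_def)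
    have refl: "(v, v) \<in> ?R" using vw by simp
    show ?thesis
    proof (cases "v = w")
      case False
      from diam[OF vw False] show ?thesis using step refl by blast
    qed (use refl in simp)
  qed
  then have "Digraph_Component.connected (with_proj G)"
    using assms(2) by (simp add: connected_conv)
  with assms(1) show ?thesis by (simp add: simple_connected_graph_def)
qed

text \<open>
  The diagonal entry 2 coincides with the distance of nonadjacent vertices, so the modified distance
  matrix is \<open>2 J - A\<close> with \<open>J\<close> the all-ones matrix and \<open>A\<close> the adjacency matrix.
\<close>

lemma diameter_two_modified_distance:
  assumes "simple_connected_graph G" and vw: "v \<in> pverts G" "w \<in> pverts G"
    and diam: "v \<noteq> w \<Longrightarrow> (v, w) \<in> parcs G \<or> (\<exists>u. (v, u) \<in> parcs G \<and> (u, w) \<in> parcs G)"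
  shows "modified_distance G v w = (if (v, w) \<in> parcs G then 1 else 2)"
proof -
  interpret pair_graph G using assms(1) by (simp add: simple_connected_graph_def)
  consider "v = w" | "(v, w) \<in> parcs G" "v \<noteq> w" | "v \<noteq> w" "(v, w) \<notin> parcs G" by blast
  then show ?thesis
  proof cases
    case 1
    then show ?thesis using no_loops' by (auto simp: modified_distance_def distance_matrix_def)
  next
    case 2
    then show ?thesis
      using distance_matrix_eq_1_iff[OF assms(1) vw] by (simp add: modified_distance_def)
  next
    case 3
    then obtain u where "(v, u) \<in> parcs G" "(u, w) \<in> parcs G" using diam by blast
    with 3 show ?thesis
      using distance_matrix_eq_2[OF pair_wf_digraph] by (simp add: modified_distance_def)
  qed
qed

definition undirected_graph :: "nat \<Rightarrow> (nat \<times> nat) list \<Rightarrow> nat pair_pre_digraph" where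
  "undirected_graph m es = \<lparr>pverts = {0..<m}, parcs = set es \<union> (set es)\<inverse>\<rparr>"

text \<open>
  Both graphs contain the 4-cycle \<open>0 1 2 3\<close>, and each of the pairwise nonadjacent vertices 4, 5, 6
  is joined to two vertices of this cycle: in the first graph to two of 0, 1, 2, in the second to the
  complementary two, one of which is 3. Replacing the neighbours on a regular part by the complementary
  half is Godsil-McKay switching.
\<close>

definition mate1_edges :: "(nat \<times> nat) list" where
  "mate1_edges = [(0,1), (1,2), (2,3), (3,0), (4,1), (4,2), (5,0), (5,2), (6,0), (6,1)]"

definition mate2_edges :: "(nat \<times> nat) list" where
  "mate2_edges = [(0,1), (1,2), (2,3), (3,0), (4,0), (4,3), (5,1), (5,3), (6,2), (6,3)]"

definition adjacent_in :: "(nat \<times> nat) list \<Rightarrow> nat \<Rightarrow> nat \<Rightarrow> bool" where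
  "adjacent_in es v w \<longleftrightarrow> (v, w) \<in> set es \<or> (w, v) \<in> set es"

text \<open>
  A well-formedness check and a diameter bound with bounded quantifiers only, so that rewriting
  decides it for a concrete list of edges.
\<close>

definition diameter_at_most_two :: "nat \<Rightarrow> (nat \<times> nat) list \<Rightarrow> bool" where
  "diameter_at_most_two m es \<longleftrightarrow>
    (\<forall>(v, w) \<in> set es. v < m \<and> w < m \<and> v \<noteq> w) \<and>
    (\<forall>v\<in>{0..<m}. \<forall>w\<in>{0..<m}. v = w \<or> adjacent_in es v w \<or>
      (\<exists>u\<in>{0..<m}. adjacent_in es v u \<and> adjacent_in es u w))"

lemma atLeastLessThan_7: "{0..<7::nat} = {0, 1, 2, 3, 4, 5, 6}"
  by auto

lemma mates_diameter: "diameter_at_most_two 7 mate1_edges" "diameter_at_most_two 7 mate2_edges"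
  unfolding diameter_at_most_two_def atLeastLessThan_7
  by (simp_all add: adjacent_in_def mate1_edges_def mate2_edges_def)

text \<open>
  The matrix \<open>J - 2 I\<close> on the 4-cycle and \<open>2 I\<close> on the other vertices: twice the orthogonal matrix
  of Godsil-McKay switching. On a vector indexed by the cycle with two entries 1 and two entries 0, the
  first block acts as twice the exchange of 0 and 1.
\<close>

definition switching :: "nat \<Rightarrow> nat \<Rightarrow> int" where
  "switching i j = (if i < 4 \<and> j < 4 then (if i = j then - 1 else 1) else if i = j then 2 else 0)"

lemma switching_intertwines:
  "\<forall>i\<in>{0..<7}. \<forall>j\<in>{0..<7}.
    (\<Sum>k\<in>{0..<7}. switching i k * (if adjacent_in mate1_edges k j then 1 else 2)) =
    (\<Sum>k\<in>{0..<7}. (if adjacent_in mate2_edges i k then 1 else 2) * switching k j)"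
  unfolding atLeastLessThan_7
  by (simp add: switching_def adjacent_in_def mate1_edges_def mate2_edges_def)

lemma switching_square:
  "\<forall>i\<in>{0..<7}. \<forall>j\<in>{0..<7}. (\<Sum>k\<in>{0..<7}. switching i k * switching k j) = (if i = j then 4 else 0)"
  unfolding atLeastLessThan_7 by (simp add: switching_def)

lemma undirected_graph_diameter_two:
  assumes "diameter_at_most_two m es" "m > 0"
  shows "simple_connected_graph (undirected_graph m es)"
    and "\<And>v w. v < m \<Longrightarrow> w < m \<Longrightarrow>
      modified_distance (undirected_graph m es) v w = (if adjacent_in es v w then 1 else 2)"
proof -
  let ?G = "undirected_graph m es"
  have arcs: "(v, w) \<in> parcs ?G \<longleftrightarrow> adjacent_in es v w" for v w
    by (auto simp: undirected_graph_def adjacent_in_def)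
  have verts: "v \<in> pverts ?G \<longleftrightarrow> v < m" for v
    by (simp add: undirected_graph_def)
  have wf: "v < m \<and> w < m \<and> v \<noteq> w" if "adjacent_in es v w" for v w
    using assms(1) that by (fastforce simp: diameter_at_most_two_def adjacent_in_def)
  have diam: "(v, w) \<in> parcs ?G \<or> (\<exists>u. (v, u) \<in> parcs ?G \<and> (u, w) \<in> parcs ?G)"
    if "v < m" "w < m" "v \<noteq> w" for v w
  proof -
    have "v = w \<or> adjacent_in es v w \<or> (\<exists>u\<in>{0..<m}. adjacent_in es v u \<and> adjacent_in es u w)"
      using assms(1) that(1,2) by (simp add: diameter_at_most_two_def)
    with that(3) show ?thesis unfolding arcs by blast
  qed
  have "pair_graph ?G"
  proof unfold_locales
    show "finite (pverts ?G)" "finite (parcs ?G)" by (simp_all add: undirected_graph_def)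
    show "symmetric (with_proj ?G)"
      by (auto simp: symmetric_def undirected_graph_def intro!: symI)
    fix e assume "e \<in> parcs ?G"
    then have "fst e < m \<and> snd e < m \<and> fst e \<noteq> snd e"
      using wf arcs[of "fst e" "snd e"] by simp
    then show "fst e \<in> pverts ?G" "snd e \<in> pverts ?G" "fst e \<noteq> snd e"
      by (simp_all add: verts)
  qed
  then show connected: "simple_connected_graph ?G"
    using assms(2) diam by (intro diameter_two_simple_connected) (auto simp: verts undirected_graph_def)
  show "modified_distance ?G v w = (if adjacent_in es v w then 1 else 2)" if "v < m" "w < m" for v w
    using diameter_two_modified_distance[OF connected, of v w] diam that by (simp add: arcs verts)
qed

lemma out_degree_undirected_graph:
  assumes "diameter_at_most_two m es"
  shows "out_degree (with_proj (undirected_graph m es)) v =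
    (\<Sum>w\<in>{0..<m}. if adjacent_in es v w then 1 else 0)"
proof -
  have "out_arcs (with_proj (undirected_graph m es)) v = Pair v ` {w \<in> {0..<m}. adjacent_in es v w}"
    using assms
    by (fastforce simp: out_arcs_def undirected_graph_def adjacent_in_def diameter_at_most_two_def)
  then have "out_degree (with_proj (undirected_graph m es)) v = card {w \<in> {0..<m}. adjacent_in es v w}"
    by (simp add: out_degree_def card_image inj_on_def)
  then show ?thesis
    by (simp only: card_eq_sum sum.inter_filter[OF finite_atLeastLessThan])
qed

text \<open>
  In the second graph vertex 3 has gained the neighbours 4, 5 and 6; this separates the two graphs.
\<close>

lemma mates_degrees:
  "out_degree (with_proj (undirected_graph 7 mate2_edges)) 3 = 5"
  "\<forall>v\<in>{0..<7}. out_degree (with_proj (undirected_graph 7 mate1_edges)) v \<noteq> 5"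
  unfolding out_degree_undirected_graph[OF mates_diameter(1)] out_degree_undirected_graph[OF mates_diameter(2)]
    atLeastLessThan_7
  by (simp_all add: adjacent_in_def mate1_edges_def mate2_edges_def)

lemma mates_not_iso:
  "\<not> digraph_iso (with_proj (undirected_graph 7 mate1_edges)) (with_proj (undirected_graph 7 mate2_edges))"
proof
  let ?G = "with_proj (undirected_graph 7 mate1_edges)"
  let ?H = "with_proj (undirected_graph 7 mate2_edges)"
  interpret pair_graph "undirected_graph 7 mate1_edges"
    using undirected_graph_diameter_two(1)[OF mates_diameter(1)] by (simp add: simple_connected_graph_def)
  assume "digraph_iso ?G ?H"
  then obtain hom where hom: "digraph_isomorphism hom" and H: "?H = app_iso hom ?G"
    by (auto simp: digraph_iso_def)
  have "3 \<in> verts ?H" by (simp add: undirected_graph_def)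
  then obtain u where u: "u \<in> verts ?G" "3 = iso_verts hom u"
    unfolding H verts_app_iso by blast
  have "out_degree ?G u = out_degree ?H 3"
    using out_degree_app_iso_eq[OF hom, of u] u unfolding H by simp
  then show False
    using mates_degrees u(1) by (simp add: undirected_graph_def)
qed

lemma mates_univariate_eq:
  "univariate_blowup_polynomial (undirected_graph 7 mate1_edges) =
    univariate_blowup_polynomial (undirected_graph 7 mate2_edges)"
proof (rule univariate_blowup_polynomial_eqI[where V = "{0..<7}" and Q = switching])
  \<comment> \<open>The square of the switching matrix is 4 times the identity.\<close>
  have "set_det {0..<7} switching * set_det {0..<7} switching =
      set_det {0..<7} (\<lambda>i j. \<Sum>k\<in>{0..<7}. switching i k * switching k j)"
    by (rule set_det_mult[symmetric]) simp
  also have "\<dots> = set_det {0..<7::nat} (\<lambda>i j. if i = j then 4 else 0)"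
    by (rule set_det_cong) (use switching_square in blast)
  also have "\<dots> \<noteq> 0" by (simp add: set_det_scalar)
  finally show "set_det {0..<7} switching \<noteq> 0" by auto
  fix i j :: nat assume ij: "i \<in> {0..<7}" "j \<in> {0..<7}"
  have "(\<Sum>k\<in>{0..<7}. switching i k * modified_distance (undirected_graph 7 mate1_edges) k j) =
      (\<Sum>k\<in>{0..<7}. switching i k * (if adjacent_in mate1_edges k j then 1 else 2))"
    using ij by (intro sum.cong refl) (simp add: undirected_graph_diameter_two(2) mates_diameter)
  also have "\<dots> = (\<Sum>k\<in>{0..<7}. (if adjacent_in mate2_edges i k then 1 else 2) * switching k j)"
    using switching_intertwines ij by blast
  also have "\<dots> = (\<Sum>k\<in>{0..<7}. modified_distance (undirected_graph 7 mate2_edges) i k * switching k j)"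
    using ij by (intro sum.cong refl) (simp add: undirected_graph_diameter_two(2) mates_diameter)
  finally show "(\<Sum>k\<in>{0..<7}. switching i k * modified_distance (undirected_graph 7 mate1_edges) k j) =
      (\<Sum>k\<in>{0..<7}. modified_distance (undirected_graph 7 mate2_edges) i k * switching k j)" .
qed (simp_all add: undirected_graph_diameter_two(1) mates_diameter, simp_all add: undirected_graph_def)

theorem proposition1p7:
  shows
    "(\<forall>(G :: 'a pair_pre_digraph) \<sigma>.
        simple_connected_graph G \<longrightarrow> card (pverts G) \<ge> 2 \<longrightarrow>
        bij_betw \<sigma> (pverts G) (pverts G) \<longrightarrow>
        (mpoly_subst (\<lambda>v. indeterminate (\<sigma> v)) (blowup_polynomial G) = blowup_polynomial G
           \<longleftrightarrow> auto_isometry G \<sigma>)) \<and>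
     (\<forall>(G :: 'a pair_pre_digraph) H.
        simple_connected_graph G \<longrightarrow> simple_connected_graph H \<longrightarrow>
        pverts G = pverts H \<longrightarrow> card (pverts G) \<ge> 2 \<longrightarrow>
        blowup_polynomial G = blowup_polynomial H \<longrightarrow> G = H) \<and>
     (\<exists>(G :: nat pair_pre_digraph) (H :: nat pair_pre_digraph).
        simple_connected_graph G \<and> simple_connected_graph H \<and>
        card (pverts G) \<ge> 2 \<and> card (pverts H) \<ge> 2 \<and>
        \<not> digraph_iso (with_proj G) (with_proj H) \<and>
        univariate_blowup_polynomial G = univariate_blowup_polynomial H)"
proof (intro conjI)
  let ?G = "undirected_graph 7 mate1_edges" and ?H = "undirected_graph 7 mate2_edges"
  have "simple_connected_graph ?G" "simple_connected_graph ?H"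
    using undirected_graph_diameter_two(1) mates_diameter by simp_all
  moreover have "card (pverts ?G) \<ge> 2" "card (pverts ?H) \<ge> 2"
    by (simp_all add: undirected_graph_def)
  ultimately show "\<exists>(G :: nat pair_pre_digraph) (H :: nat pair_pre_digraph).
      simple_connected_graph G \<and> simple_connected_graph H \<and>
      card (pverts G) \<ge> 2 \<and> card (pverts H) \<ge> 2 \<and>
      \<not> digraph_iso (with_proj G) (with_proj H) \<and>
      univariate_blowup_polynomial G = univariate_blowup_polynomial H"
    using mates_not_iso mates_univariate_eq by blast
qed (use blowup_polynomial_symmetry_iff blowup_polynomial_inj in blast)+

end
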